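(* Let $X=(X_i)_{i\in\mathbb{N}}$ be an i.i.d. sequence with values in a Polish space $\Sigma$ and common distribution $\mu$, and let $\mathcal{L}^X_n:=\frac1n\sum_{i=1}^n\delta_{X_i}$ be the empirical measures. Then for any $\tau$-measurable set $B\subset\mathrm{Prob}(\Sigma)$ with $\tau$-closure $\bar B$, $$\limsup_{n\to\infty}\frac1n\ln\mathbb{P}(\mathcal{L}^X_n\in B)\leqslant-\inf_{\nu\in\bar B}D_{\mathrm{KL}}(\nu|\mu).$$ Moreover, for $E_n(B):=\{\mathcal{L}^X_n\in B\}$, $\mathcal{O}_B:=\sum_{n=1}^\infty\mathbf{1}_{E_n(B)}$ and any $0<p<\inf_{\nu\in\bar B}D_{\mathrm{KL}}(\nu|\mu)$ there is a constant $C_{p,B}>0$ such that $$\mathbb{E}\big[e^{p\mathcal{O}_B}\big]\leqslant C_{p,B}\cdot\Big(1-\exp\big(-\inf_{\nu\in\bar B}D_{\mathrm{KL}}(\nu|\mu)\big)\Big)^{-1}\cdot\Big(1-\exp\big(-(\inf_{\nu\in\bar B}D_{\mathrm{KL}}(\nu|\mu)-p)\big)\Big)^{-1}=:K_{p,B},$$ and $\mathbb{P}(\mathcal{O}_B\geqslant k)\leqslant K_{p,B}\cdot\exp(-pk)$ for all $k\in\mathbb{N}_0$.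
   Context: $\mathbb{N}=\{1,2,\dots\}$, $\mathbb{N}_0=\mathbb{N}\cup\{0\}$. $\mathrm{Prob}(\Sigma)$ is the set of Borel probability measures on $\Sigma$, equipped with the $\tau$-topology: the coarsest topology making $\nu\mapsto\int_\Sigma f\,d\nu$ continuous for every bounded Borel measurable $f:\Sigma\to\mathbb{R}$. "$\tau$-measurable" means measurable with respect to the $\sigma$-algebra on $\mathrm{Prob}(\Sigma)$ generated by these evaluation maps. The relative entropy (Kullback–Leibler divergence) is $D_{\mathrm{KL}}(\nu|\mu):=\int_\Sigma f\ln(f)\,d\mu$ if the Radon–Nikodym derivative $f=\frac{d\nu}{d\mu}$ exists, and $D_{\mathrm{KL}}(\nu|\mu):=\infty$ otherwise. Conventions: $\inf\emptyset=\infty$, $\exp(-\infty)=0$, $\ln 0=-\infty$. *)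

theory Defs
  imports "HOL-Probability.Probability"
begin

definition Prob :: "'a::topological_space measure set" where
  "Prob = {\<nu>. prob_space \<nu> \<and> sets \<nu> = sets borel}"

definition bounded_borel :: "('a::topological_space \<Rightarrow> real) set" where
  "bounded_borel = {f \<in> borel_measurable borel. bounded (range f)}"

text \<open>Both structures on \<open>Prob\<close> are the initial ones with respect to the maps sending
  \<open>\<nu>\<close> to the integral of \<open>f\<close>, for \<open>f\<close> bounded and Borel measurable.
  The topology is finer than the weak topology, and the sigma-algebra is in general
  not the Borel sigma-algebra of the topology.\<close>

definition tau_topology :: "'a::topological_space measure topology" where
  "tau_topology = topology_generated_by
     {{\<nu> \<in> Prob. (\<integral>x. f x \<partial>\<nu>) \<in> U} | f U. f \<in> bounded_borel \<and> open U}"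

definition tau_algebra :: "'a::topological_space measure measure" where
  "tau_algebra = sigma Prob
     {{\<nu> \<in> Prob. (\<integral>x. f x \<partial>\<nu>) \<in> A} | f A. f \<in> bounded_borel \<and> A \<in> sets borel}"

lemma topspace_tau_topology: "topspace tau_topology = Prob"
proof -
  have "(\<lambda>_. 0) \<in> bounded_borel" by (simp add: bounded_borel_def)
  then have "Prob \<in> {{\<nu> \<in> Prob. (\<integral>x. f x \<partial>\<nu>) \<in> U} | f U. f \<in> bounded_borel \<and> open (U::real set)}"
    by (intro CollectI exI[of _ "\<lambda>_. 0"] exI[of _ UNIV]) auto
  then show ?thesis
    unfolding tau_topology_def topology_generated_by_topspace by blast
qed

text \<open>The library's \<open>KL_divergence\<close> is a real-valued Bochner integral, hence \<open>0\<close> if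
  the integrand is not integrable. Here the integral takes values in the extended reals: it is
  the difference of the integrals of the positive and the negative part of \<open>f * ln f\<close>. The
  negative part is at most \<open>exp (-1)\<close>, so the difference is well defined for a finite
  measure \<open>\<mu>\<close>. At \<open>f = 0\<close> the integrand is \<open>0\<close>.\<close>

definition relative_entropy :: "'a measure \<Rightarrow> 'a measure \<Rightarrow> ereal" where
  "relative_entropy \<nu> \<mu> =
     (if \<exists>f \<in> borel_measurable \<mu>. density \<mu> f = \<nu>
      then let f = (\<lambda>x. enn2real (RN_deriv \<mu> \<nu> x))
           in enn2ereal (\<integral>\<^sup>+x. ennreal (f x * ln (f x)) \<partial>\<mu>)
              - enn2ereal (\<integral>\<^sup>+x. ennreal (- (f x * ln (f x))) \<partial>\<mu>)
      else \<infinity>)"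

definition empirical_measure :: "nat \<Rightarrow> (nat \<Rightarrow> 'a::topological_space) \<Rightarrow> 'a measure" where
  "empirical_measure n x = measure_of UNIV (sets borel)
     (\<lambda>A. (\<Sum>i=1..n. emeasure (return borel (x i)) A) / of_nat n)"

lemma sets_empirical_measure: "sets (empirical_measure n x) = sets borel"
  using sets.sigma_sets_eq[of "borel :: 'a measure"]
  by (simp add: empirical_measure_def)

text \<open>The set function is countably additive, so \<open>measure_of\<close> does not fall back to
  the zero measure.\<close>

lemma emeasure_empirical_measure:
  assumes A: "A \<in> sets borel"
  shows "emeasure (empirical_measure n x) A
    = (\<Sum>i=1..n. emeasure (return borel (x i)) A) / of_nat n"
  unfolding empirical_measure_def
proof (rule emeasure_measure_of_sigma)
  let ?m = "\<lambda>A. (\<Sum>i=1..n. emeasure (return borel (x i)) A) / (of_nat n :: ennreal)"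
  show "sigma_algebra UNIV (sets (borel :: 'a measure))"
    using sets.sigma_algebra_axioms[of "borel :: 'a measure"] by simp
  show "positive (sets borel) ?m" by (simp add: positive_def)
  show "countably_additive (sets borel) ?m"
  proof (rule countably_additiveI)
    fix F :: "nat \<Rightarrow> 'a set"
    assume F: "range F \<subseteq> sets borel" "disjoint_family F"
    have "(\<Sum>j. ?m (F j)) = (\<Sum>j. \<Sum>i=1..n. emeasure (return borel (x i)) (F j)) / of_nat n"
      by simp
    also have "(\<Sum>j. \<Sum>i=1..n. emeasure (return borel (x i)) (F j))
        = (\<Sum>i=1..n. \<Sum>j. emeasure (return borel (x i)) (F j))"
      by (intro suminf_sum) auto
    also have "\<dots> = (\<Sum>i=1..n. emeasure (return borel (x i)) (\<Union>j. F j))"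
      using F by (intro sum.cong refl suminf_emeasure) auto
    finally show "(\<Sum>j. ?m (F j)) = ?m (\<Union>j. F j)" .
  qed
qed (fact A)

definition eln :: "real \<Rightarrow> ereal" where
  "eln x = (if x = 0 then -\<infinity> else ereal (ln x))"

definition eexp :: "ereal \<Rightarrow> ennreal" where
  "eexp x = (case x of ereal r \<Rightarrow> ennreal (exp r) | PInfty \<Rightarrow> \<infinity> | MInfty \<Rightarrow> 0)"

definition empirical_event ::
  "'w measure \<Rightarrow> (nat \<Rightarrow> 'w \<Rightarrow> 'a::topological_space) \<Rightarrow> 'a measure set \<Rightarrow> nat \<Rightarrow> 'w set" where
  "empirical_event M X B n = {\<omega> \<in> space M. empirical_measure n (\<lambda>i. X i \<omega>) \<in> B}"

definition num_occurrences ::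
  "'w measure \<Rightarrow> (nat \<Rightarrow> 'w \<Rightarrow> 'a::topological_space) \<Rightarrow> 'a measure set \<Rightarrow> 'w \<Rightarrow> ereal" where
  "num_occurrences M X B \<omega> = (\<Sum>n. indicator (empirical_event M X B (Suc n)) \<omega>)"

end

theory Submission
  imports Defs
begin

text \<open>The proof avoids discretisation and rests on convex duality. For bounded Borel \<open>g\<close> put
  \<open>log_mgf \<mu> g = ln (\<integral> exp g d\<mu>)\<close>. A probability measure \<open>\<nu>\<close> with
  \<open>\<integral> g d\<nu> \<le> log_mgf \<mu> g + a\<close> for every \<open>g\<close> has relative entropy at most \<open>a\<close>
  (\<open>relative_entropy_le_of_variational_bound\<close>). Hence, if \<open>a\<close> lies below the infimum \<open>I\<close> of the
  relative entropy over the \<open>\<tau>\<close>-closure of \<open>B\<close>, each measure in that closure belongs to one of the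
  open half-spaces \<open>{\<nu>. log_mgf \<mu> g + a < \<integral> g d\<nu>}\<close>.

  Finitely many of these half-spaces already cover \<open>B\<close> (\<open>finite_half_space_cover\<close>). The
  \<open>\<tau>\<close>-closure of \<open>B\<close> is in general not compact, but its image in the product of all bounded
  intervals in which the integrals can lie has compact closure. A point of this closure outside all
  the half-spaces is a positive linear functional that satisfies the variational bound; the bound
  forces sequential continuity, so by Daniell's theorem the functional is integration against a
  probability measure in the \<open>\<tau>\<close>-closure of \<open>B\<close> of entropy at most \<open>a\<close>, which is impossible.

  By the Chernoff bound the empirical measure of \<open>n\<close> variables lies in a given half-space with
  probability at most \<open>exp (- a * n)\<close>. A union bound gives
  \<open>P(E n) \<le> C * exp (- a * n)\<close> for all \<open>n \<ge> 1\<close>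
  (\<open>empirical_event_exponential_bound\<close>), and letting \<open>a\<close> increase to \<open>I\<close> proves the bound on the
  upper limit. For the number \<open>O\<close> of occurrences,
  \<open>exp (p * O) \<le> 1 + (\<Sum>n\<ge>1. exp (p * n) * indicator (E n))\<close>; for \<open>p < a < I\<close> the expectation of the
  right-hand side is dominated by a geometric series. The two inverse factors in the claimed bound
  are at least \<open>1\<close>, so any constant above the exponential moment will do, and the tail estimate is
  Markov's inequality.\<close>

section \<open>Bounded Borel functions\<close>

lemma bounded_borelD:
  assumes "f \<in> bounded_borel"
  shows "f \<in> borel_measurable borel" and "\<exists>b>0. \<forall>x. \<bar>f x\<bar> \<le> b"
  using assms by (auto simp: bounded_borel_def bounded_pos)

lemma bounded_borelI:
  assumes "f \<in> borel_measurable borel" and "\<And>x. \<bar>f x\<bar> \<le> b"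
  shows "f \<in> bounded_borel"
  using assms by (auto simp: bounded_borel_def intro!: boundedI[where B = b])

lemma bounded_borel_between:
  assumes "f \<in> borel_measurable borel" and "g \<in> bounded_borel" and "\<And>x. 0 \<le> f x" and "\<And>x. f x \<le> g x"
  shows "f \<in> bounded_borel"
proof -
  obtain b where "\<forall>x. \<bar>g x\<bar> \<le> b" using bounded_borelD(2)[OF assms(2)] by blast
  then show ?thesis using assms(3,4) by (intro bounded_borelI[OF assms(1), of b]) (smt (verit))
qed

lemma bounded_borel_const [simp]: "(\<lambda>x. c) \<in> bounded_borel"
  by (rule bounded_borelI[of _ "\<bar>c\<bar>"]) auto

lemma bounded_borel_indicator [simp]: "A \<in> sets borel \<Longrightarrow> indicator A \<in> bounded_borel"
  by (rule bounded_borelI[of _ 1]) (auto simp: indicator_def)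

lemma bounded_borel_scale:
  assumes "f \<in> bounded_borel" shows "(\<lambda>x. c * f x) \<in> bounded_borel"
proof -
  obtain b where "\<forall>x. \<bar>f x\<bar> \<le> b" using bounded_borelD(2)[OF assms] by blast
  then show ?thesis
    using bounded_borelD(1)[OF assms]
    by (intro bounded_borelI[of _ "\<bar>c\<bar> * b"]) (auto simp: abs_mult intro!: mult_left_mono)
qed

lemma bounded_borel_add:
  assumes "f \<in> bounded_borel" "g \<in> bounded_borel" shows "(\<lambda>x. f x + g x) \<in> bounded_borel"
proof -
  obtain b where "\<forall>x. \<bar>f x\<bar> \<le> b" using bounded_borelD(2)[OF assms(1)] by blast
  moreover obtain c where "\<forall>x. \<bar>g x\<bar> \<le> c" using bounded_borelD(2)[OF assms(2)] by blast
  ultimately show ?thesis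
    using bounded_borelD(1)[OF assms(1)] bounded_borelD(1)[OF assms(2)]
    by (intro bounded_borelI[of _ "b + c"]) (auto intro: order_trans[OF abs_triangle_ineq] add_mono)
qed

lemma bounded_borel_diff:
  assumes "f \<in> bounded_borel" "g \<in> bounded_borel" shows "(\<lambda>x. f x - g x) \<in> bounded_borel"
  using bounded_borel_add[OF assms(1) bounded_borel_scale[OF assms(2), of "-1"]] by simp

lemma ProbD:
  assumes "\<nu> \<in> Prob" shows "prob_space \<nu>" "sets \<nu> = sets borel" "space \<nu> = UNIV"
  using assms sets_eq_imp_space_eq[of \<nu> borel] by (auto simp: Prob_def)

lemma bounded_borel_integrable:
  assumes "\<nu> \<in> Prob" "f \<in> bounded_borel" shows "integrable \<nu> f"
proof -
  interpret prob_space \<nu> by (rule ProbD[OF assms(1)])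
  obtain b where b: "\<forall>x. \<bar>f x\<bar> \<le> b" using bounded_borelD(2)[OF assms(2)] by blast
  have "f \<in> borel_measurable \<nu>"
    using bounded_borelD(1)[OF assms(2)] measurable_cong_sets[OF ProbD(2)[OF assms(1)] refl] by blast
  then show ?thesis using b by (intro integrable_const_bound[of _ b]) auto
qed

section \<open>Representation of positive linear functionals\<close>

text \<open>The Daniell form of the representation theorem. The only candidate for the value of \<open>\<nu>\<close> at
  \<open>A\<close> is \<open>m (indicator A)\<close>; continuity of \<open>m\<close> along sequences decreasing to \<open>0\<close> makes this set
  function continuous at the empty set, hence countably additive.\<close>

lemma daniell_representation:
  fixes m :: "('a::topological_space \<Rightarrow> real) \<Rightarrow> real"
  assumes add: "\<And>f g. f \<in> bounded_borel \<Longrightarrow> g \<in> bounded_borel \<Longrightarrow> m (\<lambda>x. f x + g x) = m f + m g"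
    and scale: "\<And>c f. f \<in> bounded_borel \<Longrightarrow> m (\<lambda>x. c * f x) = c * m f"
    and pos: "\<And>f. f \<in> bounded_borel \<Longrightarrow> (\<And>x. 0 \<le> f x) \<Longrightarrow> 0 \<le> m f"
    and unit: "m (\<lambda>x. 1) = 1"
    and cont: "\<And>G. (\<And>n. G n \<in> bounded_borel) \<Longrightarrow> (\<And>n x. 0 \<le> G n x) \<Longrightarrow> (\<And>x. decseq (\<lambda>n. G n x))
        \<Longrightarrow> (\<And>x. (\<lambda>n. G n x) \<longlonglongrightarrow> 0) \<Longrightarrow> (\<lambda>n. m (G n)) \<longlonglongrightarrow> 0"
  obtains \<nu> where "\<nu> \<in> Prob" "\<And>f. f \<in> bounded_borel \<Longrightarrow> (\<integral>x. f x \<partial>\<nu>) = m f"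
proof -
  define v where "v A = ennreal (m (indicator A))" for A :: "'a set"
  have v0: "v {} = 0" using scale[of "\<lambda>x. 1" 0] by (simp add: v_def indicator_def[abs_def] )
  have v_pos: "positive (sets borel) v" using v0 by (simp add: positive_def)
  have v_add: "additive (sets borel) v"
    unfolding additive_def
  proof (intro ballI impI)
    fix A B :: "'a set" assume AB: "A \<in> sets borel" "B \<in> sets borel" "A \<inter> B = {}"
    have "indicator (A \<union> B) = (\<lambda>x. indicator A x + indicator B x :: real)"
      using AB(3) by (auto simp: indicator_def fun_eq_iff)
    then have "m (indicator (A \<union> B)) = m (indicator A) + m (indicator B)"
      using add[of "indicator A" "indicator B"] AB by simp
    then show "v (A \<union> B) = v A + v B"
      using pos[of "indicator A"] pos[of "indicator B"] AB by (simp add: v_def ennreal_plus)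
  qed
  define \<nu> where "\<nu> = measure_of UNIV (sets borel) v"
  have sets_\<nu> [measurable_cong]: "sets \<nu> = sets borel"
    using sets.sigma_sets_eq[of "borel :: 'a measure"] by (simp add: \<nu>_def)
  have em: "emeasure \<nu> A = v A" if "A \<in> sets borel" for A
    unfolding \<nu>_def
  proof (rule emeasure_measure_of_sigma)
    show "sigma_algebra UNIV (sets (borel :: 'a measure))"
      using sets.sigma_algebra_axioms[of "borel :: 'a measure"] by simp
    show "countably_additive (sets borel) v"
    proof (rule sets.empty_continuous_imp_countably_additive[OF v_pos v_add])
      show "\<forall>A\<in>sets borel. v A \<noteq> \<infinity>" by (simp add: v_def)
      fix A :: "nat \<Rightarrow> 'a set"
      assume A: "range A \<subseteq> sets borel" "decseq A" "(\<Inter>i. A i) = {}"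
      have "(\<lambda>n. m (indicator (A n))) \<longlonglongrightarrow> 0"
      proof (rule cont)
        show "indicator (A n) \<in> bounded_borel" for n using A by auto
        show "decseq (\<lambda>n. indicator (A n) x :: real)" for x
          using A(2) by (auto simp: decseq_def indicator_def)
        show "(\<lambda>n. indicator (A n) x :: real) \<longlonglongrightarrow> 0" for x
          using LIMSEQ_indicator_decseq[OF A(2), of x] unfolding A(3) by simp
      qed simp
      from tendsto_ennrealI[OF this] show "(\<lambda>i. v (A i)) \<longlonglongrightarrow> 0" by (simp add: v_def)
    qed
  qed (use that v_pos in auto)
  have space_\<nu>: "space \<nu> = UNIV" using sets_eq_imp_space_eq[OF sets_\<nu>] by simp
  have "emeasure \<nu> (space \<nu>) = 1"
    using em[of UNIV] unit by (simp add: space_\<nu> v_def indicator_def[abs_def])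
  then interpret prob_space \<nu> by (rule prob_spaceI)
  have Prob: "\<nu> \<in> Prob" by (simp add: Prob_def sets_\<nu> prob_space_axioms)
  note int = bounded_borel_integrable[OF Prob]
  \<comment> \<open>The induction passes through all nonnegative Borel functions, bounded or not, so boundedness
    has to be a premise of the claim that is proved.\<close>
  have nonneg: "f \<in> bounded_borel \<longrightarrow> (\<integral>x. f x \<partial>\<nu>) = m f"
    if "f \<in> borel_measurable borel" "\<And>x. 0 \<le> f x" for f
    using that
  proof (induction f rule: borel_measurable_induct_real)
    case (set A)
    then show ?case
      using em[of A] pos[of "indicator A"] by (auto simp: v_def measure_def space_\<nu>)
  next
    case (mult u c)
    show ?case
    proof
      assume "(\<lambda>x. c * u x) \<in> bounded_borel"
      from bounded_borel_scale[OF this, of "inverse c"]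
      have "c = 0 \<or> u \<in> bounded_borel" by (cases "c = 0") (simp_all add: mult.assoc[symmetric])
      then show "(\<integral>x. c * u x \<partial>\<nu>) = m (\<lambda>x. c * u x)"
        using mult.IH scale[of u c] scale[of "\<lambda>x. 1" 0] by auto
    qed
  next
    case (add u v)
    show ?case
    proof
      assume *: "(\<lambda>x. v x + u x) \<in> bounded_borel"
      have "u \<in> bounded_borel" "v \<in> bounded_borel"
        using add.hyps by (auto intro!: bounded_borel_between[OF _ *])
      then show "(\<integral>x. v x + u x \<partial>\<nu>) = m (\<lambda>x. v x + u x)"
        using add.IH assms(1)[of v u] int by (simp)
    qed
  next
    case (seq U)
    have le: "U i x \<le> f x" for i x
      using seq.hyps(3) by (intro incseq_le[OF _ seq.hyps(4)]) (auto simp: incseq_def le_fun_def)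
    show ?case
    proof
      assume f: "f \<in> bounded_borel"
      have U: "U i \<in> bounded_borel" for i
        using seq.hyps le by (intro bounded_borel_between[OF _ f]) auto
      have d: "(\<lambda>x. f x - U i x) \<in> bounded_borel" for i by (rule bounded_borel_diff[OF f U])
      have "(\<lambda>i. m (\<lambda>x. f x - U i x)) \<longlonglongrightarrow> 0"
      proof (rule cont[OF d])
        show "decseq (\<lambda>n. f x - U n x)" for x
          using seq.hyps(3) by (auto simp: incseq_def decseq_def le_fun_def)
        show "(\<lambda>n. f x - U n x) \<longlonglongrightarrow> 0" for x
          using tendsto_diff[OF tendsto_const seq.hyps(4), of x "f x"] by simp
      qed (use le in auto)
      moreover have "m (\<lambda>x. f x - U i x) = m f - m (U i)" for i
        using assms(1)[OF d U, of i i] by simp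
      ultimately have "(\<lambda>i. m f - (m f - m (U i))) \<longlonglongrightarrow> m f - 0"
        by (intro tendsto_intros) simp
      then have "(\<lambda>i. \<integral>x. U i x \<partial>\<nu>) \<longlonglongrightarrow> m f" using seq.IH U by simp
      moreover have "(\<lambda>i. \<integral>x. U i x \<partial>\<nu>) \<longlonglongrightarrow> (\<integral>x. f x \<partial>\<nu>)"
      proof (rule integral_dominated_convergence[where w = f])
        show "f \<in> borel_measurable \<nu>" "U i \<in> borel_measurable \<nu>" for i
          using int[OF f] int[OF U] by auto
      qed (use int[OF f] seq.hyps le in auto)
      ultimately show "(\<integral>x. f x \<partial>\<nu>) = m f" by (intro LIMSEQ_unique)
    qed
  qed
  show ?thesis
  proof (rule that[OF Prob])
    fix f :: "'a \<Rightarrow> real" assume f: "f \<in> bounded_borel"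
    \<comment> \<open>A lower bound reduces the general case to the nonnegative one.\<close>
    obtain b where b: "\<forall>x. \<bar>f x\<bar> \<le> b" using bounded_borelD(2)[OF f] by blast
    have fb: "(\<lambda>x. f x + b) \<in> bounded_borel" by (intro bounded_borel_add f) simp
    have "0 \<le> f x + b" for x using b by (smt (verit))
    with nonneg[of "\<lambda>x. f x + b"] fb have "(\<integral>x. f x + b \<partial>\<nu>) = m (\<lambda>x. f x + b)"
      using bounded_borelD(1) by blast
    then show "(\<integral>x. f x \<partial>\<nu>) = m f"
      using add[OF f, of "\<lambda>x. b"] scale[of "\<lambda>x. 1" b] unit int[OF f] by (simp add: prob_space)
  qed
qed

section \<open>The variational bound on relative entropy\<close>

definition log_mgf :: "'a measure \<Rightarrow> ('a \<Rightarrow> real) \<Rightarrow> real" where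
  "log_mgf \<mu> g = ln (\<integral>x. exp (g x) \<partial>\<mu>)"

lemma bounded_borel_exp:
  assumes "g \<in> bounded_borel" shows "(\<lambda>x. exp (g x)) \<in> bounded_borel"
proof -
  obtain b where b: "\<forall>x. \<bar>g x\<bar> \<le> b" using bounded_borelD(2)[OF assms] by blast
  have "g x \<le> b" for x using b[rule_format, of x] by simp
  then show ?thesis using bounded_borelD(1)[OF assms]
    by (intro bounded_borelI[of _ "exp b"]) auto
qed

lemma integral_exp_pos:
  assumes "\<mu> \<in> Prob" "g \<in> bounded_borel" shows "0 < (\<integral>x. exp (g x) \<partial>\<mu>)"
proof -
  interpret prob_space \<mu> by (rule ProbD[OF assms(1)])
  have "(\<integral>x. exp (g x) \<partial>\<mu>) \<noteq> 0"
    using integral_nonneg_eq_0_iff_AE[OF bounded_borel_integrable[OF assms(1) bounded_borel_exp[OF assms(2)]]]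
    by (auto simp: AE_False)
  then show ?thesis by (simp add: less_le)
qed

lemma neg_mult_ln_le_1: "- (x * ln x) \<le> 1" if "0 \<le> x" for x :: real
proof (cases "x = 0")
  case False
  with that have "x * ln (inverse x) \<le> x * (inverse x - 1)"
    by (intro mult_left_mono ln_le_minus_one) auto
  with that False show ?thesis by (simp add: ln_inverse algebra_simps)
qed simp

text \<open>The optimal test function would be \<open>ln f\<close>, because \<open>exp (ln f)\<close> has \<open>\<mu>\<close>-integral \<open>1\<close>; it
  need not be bounded. Clipping \<open>f\<close> to the interval from \<open>1 / (n + 1)\<close> to \<open>n + 1\<close> gives bounded
  test functions whose exponential has integral at most \<open>1 + 1 / (n + 1)\<close>, and Fatou's lemma
  passes to the limit. The function \<open>f * g n\<close> is bounded below by minus the negative part of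
  \<open>f * ln f\<close>, so adding that part makes the integrands nonnegative.\<close>

lemma nn_integral_le_of_variational_bound:
  fixes \<mu> :: "'a::topological_space measure"
  assumes \<mu>: "\<mu> \<in> Prob" and \<nu>: "\<nu> \<in> Prob"
    and le: "\<And>g. g \<in> bounded_borel \<Longrightarrow> (\<integral>x. g x \<partial>\<nu>) \<le> log_mgf \<mu> g + a"
    and f[measurable]: "f \<in> borel_measurable borel" and f0: "\<And>x. 0 \<le> f x"
    and dens: "density \<mu> (\<lambda>x. ennreal (f x)) = \<nu>"
  shows "(\<integral>\<^sup>+x. ennreal (f x * ln (f x)) \<partial>\<mu>)
      \<le> (\<integral>\<^sup>+x. ennreal (- (f x * ln (f x))) \<partial>\<mu>) + ennreal a"
proof -
  interpret \<mu>: prob_space \<mu> by (rule ProbD[OF \<mu>])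
  interpret \<nu>: prob_space \<nu> by (rule ProbD[OF \<nu>])
  note [measurable_cong] = ProbD(2)[OF \<mu>]
  have a0: "0 \<le> a" using le[of "\<lambda>x. 0"] by (simp add: log_mgf_def \<mu>.prob_space)
  have "(\<integral>\<^sup>+x. ennreal (f x) \<partial>\<mu>) = 1"
    using \<nu>.emeasure_space_1 unfolding dens[symmetric] by (simp add: emeasure_density)
  then have f_int: "integrable \<mu> f" and f_1: "(\<integral>x. f x \<partial>\<mu>) = 1"
    using f0 by (auto intro!: integrableI_nn_integral_finite[where x = 1] simp: integral_eq_nn_integral)
  define g where "g n x = ln (max (1 / real (Suc n)) (min (f x) (real (Suc n))))" for n x
  define N where "N x = max 0 (- (f x * ln (f x)))" for x
  have g_meas[measurable]: "g n \<in> borel_measurable borel" for n by (simp add: g_def[abs_def])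
  have pos: "0 < 1 / real (Suc n)" "1 / real (Suc n) \<le> 1" for n by auto
  have clip_pos: "0 < max (1 / real (Suc n)) (min (f x) (real (Suc n)))" for n x
    using pos(1)[of n] by (simp add: less_max_iff_disj)
  have g_abs: "\<bar>g n x\<bar> \<le> ln (real (Suc n))" for n x
  proof -
    have "ln (1 / real (Suc n)) \<le> g n x"
      unfolding g_def using pos[of n] clip_pos[of n x] by (subst ln_le_cancel_iff) (auto simp del: of_nat_Suc)
    moreover have "g n x \<le> ln (real (Suc n))"
      unfolding g_def using pos[of n] clip_pos[of n x] by (subst ln_le_cancel_iff) (auto simp del: of_nat_Suc intro: order_trans[of _ 1])
    ultimately show ?thesis by (simp add: ln_div del: of_nat_Suc)
  qed
  have g_bb: "g n \<in> bounded_borel" for n by (rule bounded_borelI[OF g_meas g_abs])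
  have exp_g: "exp (g n x) = max (1 / real (Suc n)) (min (f x) (real (Suc n)))" for n x
    unfolding g_def by (rule exp_ln[OF clip_pos])
  have mgf: "log_mgf \<mu> (g n) \<le> 1 / real (Suc n)" for n
  proof -
    have "(\<integral>x. exp (g n x) \<partial>\<mu>) \<le> (\<integral>x. 1 / real (Suc n) + f x \<partial>\<mu>)"
      using f0 pos[of n] bounded_borel_integrable[OF \<mu> bounded_borel_exp[OF g_bb]] f_int
      by (intro integral_mono) (auto simp: exp_g min_le_iff_disj simp del: of_nat_Suc)
    also have "\<dots> = 1 + 1 / real (Suc n)" using f_int by (simp add: f_1 \<mu>.prob_space)
    finally show ?thesis
      unfolding log_mgf_def using integral_exp_pos[OF \<mu> g_bb[of n]] ln_add_one_self_le_self[of "1 / real (Suc n)"]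
      by (smt (verit) ln_mono pos(1))
  qed
  have N_le: "N x \<le> 1" for x
    using neg_mult_ln_le_1[OF f0, of x] by (simp add: N_def)
  have N_meas[measurable]: "N \<in> borel_measurable borel" unfolding N_def[abs_def] by measurable
  have N_int: "integrable \<mu> N"
    by (rule \<mu>.integrable_const_bound[of _ 1]) (use N_le in \<open>simp_all add: N_def\<close>)
  have fg_int: "integrable \<mu> (\<lambda>x. f x * g n x)" for n
    using f_int bounded_borelD(1)[OF g_bb]
    by (rule_tac Bochner_Integration.integrable_bound[OF integrable_mult_right[OF f_int, of "ln (real (Suc n))"]])
       (auto simp: abs_mult mult.commute f0 intro!: mult_mono g_abs order_trans[OF g_abs] simp del: of_nat_Suc)
  have lower: "0 \<le> f x * g n x + N x" for n x
  proof (cases "f x < 1 / real (Suc n)")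
    case True
    show ?thesis
    proof (cases "f x = 0")
      case False
      then have "0 < f x" using f0[of x] by simp
      then have "ln (f x) \<le> g n x"
        unfolding g_def using True pos[of n] clip_pos[of n x] by (subst ln_le_cancel_iff) (auto simp del: of_nat_Suc)
      then have "f x * ln (f x) \<le> f x * g n x" using f0 by (intro mult_left_mono)
      then show ?thesis unfolding N_def by linarith
    qed (simp add: N_def)
  next
    case False
    show ?thesis
    proof (cases "f x \<le> real (Suc n)")
      case True
      then have "g n x = ln (f x)" using False by (simp add: g_def del: of_nat_Suc)
      then show ?thesis unfolding N_def by simp
    next
      case *: False
      then have "g n x \<ge> 0" using pos[of n] by (simp add: g_def del: of_nat_Suc)
      then show ?thesis using f0 by (simp add: N_def)
    qed
  qed
  have bound: "(\<integral>\<^sup>+x. ennreal (f x * g n x + N x) \<partial>\<mu>) \<le> ennreal (a + 1 / real (Suc n) + (\<integral>x. N x \<partial>\<mu>))" for n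
  proof -
    have "(\<integral>\<^sup>+x. ennreal (f x * g n x + N x) \<partial>\<mu>) = ennreal (\<integral>x. f x * g n x + N x \<partial>\<mu>)"
      using lower fg_int N_int by (intro nn_integral_eq_integral) auto
    also have "(\<integral>x. f x * g n x + N x \<partial>\<mu>) = (\<integral>x. g n x \<partial>\<nu>) + (\<integral>x. N x \<partial>\<mu>)"
      using fg_int N_int f0 by (simp add: dens[symmetric] integral_density)
    also have "\<dots> \<le> ennreal (a + 1 / real (Suc n) + (\<integral>x. N x \<partial>\<mu>))"
      using le[OF g_bb, of n] mgf[of n] by (intro ennreal_leI) linarith
    finally show ?thesis .
  qed
  have lim: "(\<lambda>n. f x * g n x + N x) \<longlonglongrightarrow> f x * ln (f x) + N x" for x
  proof (cases "f x = 0")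
    case False
    then have "0 < f x" using f0[of x] by simp
    then obtain k where k: "1 / f x + f x < real k" using reals_Archimedean2 by blast
    have "g n x = ln (f x)" if "k \<le> n" for n
    proof -
      have "1 / f x < real (Suc n)" "f x < real (Suc n)" using k that \<open>0 < f x\<close>
        by (smt (verit) divide_pos_pos of_nat_mono of_nat_Suc)+
      then show ?thesis using \<open>0 < f x\<close> by (simp add: g_def field_simps del: of_nat_Suc)
    qed
    then have "eventually (\<lambda>n. f x * ln (f x) + N x = f x * g n x + N x) sequentially"
      by (intro eventually_sequentiallyI[of k]) simp
    then show ?thesis by (rule Lim_transform_eventually[OF tendsto_const])
  qed simp
  have "(\<integral>\<^sup>+x. ennreal (f x * ln (f x) + N x) \<partial>\<mu>)
      = (\<integral>\<^sup>+x. liminf (\<lambda>n. ennreal (f x * g n x + N x)) \<partial>\<mu>)"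
    by (intro nn_integral_cong lim_imp_Liminf[symmetric] tendsto_ennrealI lim) simp
  also have "\<dots> \<le> liminf (\<lambda>n. \<integral>\<^sup>+x. ennreal (f x * g n x + N x) \<partial>\<mu>)"
    by (intro nn_integral_liminf) (simp add: N_def)
  also have "\<dots> \<le> liminf (\<lambda>n. ennreal (a + 1 / real (Suc n) + (\<integral>x. N x \<partial>\<mu>)))"
    using bound by (intro Liminf_mono always_eventually) auto
  also have "\<dots> = ennreal (a + 0 + (\<integral>x. N x \<partial>\<mu>))"
    by (intro lim_imp_Liminf tendsto_ennrealI tendsto_intros LIMSEQ_Suc[OF lim_1_over_n]) simp
  also have "\<dots> = ennreal a + (\<integral>\<^sup>+x. ennreal (N x) \<partial>\<mu>)"
  proof -
    have "(\<integral>\<^sup>+x. ennreal (N x) \<partial>\<mu>) = ennreal (\<integral>x. N x \<partial>\<mu>)"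
      by (rule nn_integral_eq_integral[OF N_int]) (simp add: N_def)
    moreover have "0 \<le> (\<integral>x. N x \<partial>\<mu>)" by (simp add: N_def)
    ultimately show ?thesis using a0 by simp
  qed
  finally have "(\<integral>\<^sup>+x. ennreal (f x * ln (f x) + N x) \<partial>\<mu>) \<le> ennreal a + (\<integral>\<^sup>+x. ennreal (N x) \<partial>\<mu>)" .
  moreover have "ennreal (f x * ln (f x) + N x) = ennreal (f x * ln (f x))" for x
    by (auto simp: N_def max_def ennreal_neg)
  moreover have "ennreal (N x) = ennreal (- (f x * ln (f x)))" for x
    by (auto simp: N_def max_def ennreal_neg)
  ultimately show ?thesis using a0 by (simp add: add.commute)
qed

text \<open>The nontrivial half of the Donsker--Varadhan formula. Testing with large multiples of
  \<open>indicator A\<close> for a null set \<open>A\<close> gives absolute continuity, so a density exists.\<close>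

lemma relative_entropy_le_of_variational_bound:
  fixes \<mu> :: "'a::topological_space measure"
  assumes \<mu>: "\<mu> \<in> Prob" and \<nu>: "\<nu> \<in> Prob"
    and le: "\<And>g. g \<in> bounded_borel \<Longrightarrow> (\<integral>x. g x \<partial>\<nu>) \<le> log_mgf \<mu> g + a"
  shows "relative_entropy \<nu> \<mu> \<le> ereal a"
proof -
  interpret \<mu>: prob_space \<mu> by (rule ProbD[OF \<mu>])
  interpret \<nu>: prob_space \<nu> by (rule ProbD[OF \<nu>])
  note [measurable_cong] = ProbD(2)[OF \<mu>]
  have sets_eq: "sets \<nu> = sets \<mu>" using ProbD(2) \<mu> \<nu> by blast
  have ac: "absolutely_continuous \<mu> \<nu>"
    unfolding absolutely_continuous_def
  proof
    fix A assume A: "A \<in> null_sets \<mu>"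
    then have A_borel: "A \<in> sets borel" using ProbD(2)[OF \<mu>] by auto
    have "t * measure \<nu> A \<le> a" for t :: real
    proof -
      have "(\<integral>x. exp (t * indicator A x) \<partial>\<mu>) = (\<integral>x. 1 \<partial>\<mu>)"
        using AE_not_in[OF A] A_borel by (intro integral_cong_AE) (auto simp: indicator_def)
      then show ?thesis
        using le[OF bounded_borel_scale[OF bounded_borel_indicator[OF A_borel]], of t] A_borel ProbD[OF \<nu>]
        by (simp add: log_mgf_def \<mu>.prob_space)
    qed
    \<comment> \<open>This multiple would make the left-hand side \<open>\<bar>a\<bar> + 1\<close>.\<close>
    from this[of "(\<bar>a\<bar> + 1) / measure \<nu> A"] have "measure \<nu> A = 0" by (cases "measure \<nu> A = 0") auto
    then show "A \<in> null_sets \<nu>"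
      using A sets_eq by (auto simp: null_sets_def \<nu>.emeasure_eq_measure)
  qed
  define f where "f x = enn2real (RN_deriv \<mu> \<nu> x)" for x
  have dens: "density \<mu> (RN_deriv \<mu> \<nu>) = \<nu>" by (rule \<mu>.density_RN_deriv[OF ac sets_eq])
  have f_eq: "AE x in \<mu>. ennreal (f x) = RN_deriv \<mu> \<nu> x"
    using \<mu>.RN_deriv_finite[OF \<nu>.sigma_finite_measure_axioms ac sets_eq]
    by eventually_elim (auto simp: f_def less_top)
  have f_meas: "f \<in> borel_measurable \<mu>" by (simp add: f_def[abs_def])
  have dens_f: "density \<mu> (\<lambda>x. ennreal (f x)) = \<nu>"
    using density_cong[OF _ _ f_eq] f_meas dens by simp
  have "f \<in> borel_measurable borel" using f_meas measurable_cong_sets[OF ProbD(2)[OF \<mu>] refl] by blast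
  from nn_integral_le_of_variational_bound[OF \<mu> \<nu> le this _ dens_f]
  have main: "(\<integral>\<^sup>+x. ennreal (f x * ln (f x)) \<partial>\<mu>)
      \<le> (\<integral>\<^sup>+x. ennreal (- (f x * ln (f x))) \<partial>\<mu>) + ennreal a" by (simp add: f_def)
  have a0: "0 \<le> a" using le[of "\<lambda>x. 0"] by (simp add: log_mgf_def \<mu>.prob_space)
  have "(\<integral>\<^sup>+x. ennreal (- (f x * ln (f x))) \<partial>\<mu>) \<le> (\<integral>\<^sup>+x. 1 \<partial>\<mu>)"
  proof (rule nn_integral_mono)
    fix x
    have "- (f x * ln (f x)) \<le> 1" by (rule neg_mult_ln_le_1) (simp add: f_def)
    then show "ennreal (- (f x * ln (f x))) \<le> 1" by (simp add: ennreal_le_1)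
  qed
  then have "(\<integral>\<^sup>+x. ennreal (- (f x * ln (f x))) \<partial>\<mu>) < top"
    by (simp add: \<mu>.emeasure_space_1 le_less_trans)
  then obtain c where c: "(\<integral>\<^sup>+x. ennreal (- (f x * ln (f x))) \<partial>\<mu>) = ennreal c" "0 \<le> c"
    by (cases "\<integral>\<^sup>+x. ennreal (- (f x * ln (f x))) \<partial>\<mu>" rule: ennreal_cases) auto
  have "(\<integral>\<^sup>+x. ennreal (f x * ln (f x)) \<partial>\<mu>) \<le> ennreal (c + a)"
    using main c a0 by (simp add: ennreal_plus)
  then obtain d where d: "(\<integral>\<^sup>+x. ennreal (f x * ln (f x)) \<partial>\<mu>) = ennreal d" "0 \<le> d" "d \<le> c + a"
    using c(2) a0 by (cases "\<integral>\<^sup>+x. ennreal (f x * ln (f x)) \<partial>\<mu>")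
      (auto simp: top_unique simp del: ennreal_plus)
  have "relative_entropy \<nu> \<mu> = ereal (d - c)"
    using dens c d unfolding relative_entropy_def Let_def f_def[symmetric]
    by (auto simp: enn2ereal_ennreal)
  then show ?thesis using d(3) by simp
qed

section \<open>Compactness and the finite cover by half-spaces\<close>

text \<open>The map \<open>tau_embedding\<close> identifies a measure with the family of its integrals, a point of a
  product of copies of the real line. The product runs over all functions, so that the product
  topology is the topology of a type; the coordinates outside \<open>bounded_borel\<close> are pinned to \<open>0\<close>.\<close>

definition tau_embedding :: "'a::topological_space measure \<Rightarrow> ('a \<Rightarrow> real) \<Rightarrow> real" where
  "tau_embedding \<nu> f = (if f \<in> bounded_borel then \<integral>x. f x \<partial>\<nu> else 0)"

text \<open>The \<open>\<tau>\<close>-topology is coarser than the topology pulled back from the product along the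
  embedding, because the sets that generate it are preimages of open sets.\<close>

lemma closure_tau_embedding_imp_tau_closure:
  fixes B :: "'a::topological_space measure set"
  assumes "\<nu> \<in> Prob" and "tau_embedding \<nu> \<in> closure (tau_embedding ` B)" and "B \<subseteq> Prob"
  shows "\<nu> \<in> tau_topology closure_of B"
proof -
  let ?S = "{{\<nu> \<in> Prob. (\<integral>x. f x \<partial>\<nu>) \<in> U} | f U. f \<in> bounded_borel \<and> open U} :: 'a measure set set"
  have "\<exists>y. y \<in> B \<and> y \<in> T" if T: "\<nu> \<in> T" "openin tau_topology T" for T
  proof -
    have "generate_topology_on ?S T"
      using T(2) unfolding tau_topology_def by (rule openin_topology_generated_by)
    then have "openin (pullback_topology Prob tau_embedding euclidean) T"
    proof (rule generate_topology_on_coarsest[OF istopology_openin, rotated])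
      fix T assume "T \<in> ?S"
      then obtain f U where fU: "f \<in> bounded_borel" "open U" "T = {\<nu> \<in> Prob. (\<integral>x. f x \<partial>\<nu>) \<in> U}" by blast
      have "open ((\<lambda>m :: ('a \<Rightarrow> real) \<Rightarrow> real. m f) -` U)"
        using fU(2) by (rule open_vimage) simp
      then show "openin (pullback_topology Prob tau_embedding euclidean) T"
        unfolding openin_pullback_topology using fU
        by (intro exI[of _ "(\<lambda>m. m f) -` U"]) (auto simp: tau_embedding_def)
    qed
    then obtain V where V: "open V" "T = tau_embedding -` V \<inter> Prob"
      by (auto simp: openin_pullback_topology)
    then have "V \<inter> tau_embedding ` B \<noteq> {}"
      using assms(2) T(1) by (auto simp: closure_iff_nhds_not_empty)
    then show ?thesis using V assms(3) by blast
  qed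
  then show ?thesis using assms(1) by (simp add: in_closure_of topspace_tau_topology)
qed

text \<open>Tychonoff's theorem.\<close>

lemma compact_pointwise_bounded: "compact {m :: 'i \<Rightarrow> real. \<forall>f. \<bar>m f\<bar> \<le> b f}"
proof -
  have "compactin (product_topology (\<lambda>_. euclideanreal) UNIV) (\<Pi>\<^sub>E f\<in>UNIV. {- b f..b f})"
    by (subst compactin_PiE) simp
  moreover have "(\<Pi>\<^sub>E f\<in>UNIV. {- b f..b f}) = {m. \<forall>f. \<bar>m f\<bar> \<le> b f}"
    by (auto simp: PiE_iff abs_le_iff minus_le_iff)
  ultimately show ?thesis by (simp add: euclidean_product_topology)
qed

text \<open>A limit of families of integrals need not come from a measure, but each of these relations is
  a closed condition on finitely many coordinates and survives in the limit.\<close>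

lemma closure_tau_embedding_linear:
  assumes "B \<subseteq> Prob" and "m \<in> closure (tau_embedding ` B)"
  shows "f \<in> bounded_borel \<Longrightarrow> g \<in> bounded_borel \<Longrightarrow> m (\<lambda>x. f x + g x) = m f + m g"
    and "f \<in> bounded_borel \<Longrightarrow> m (\<lambda>x. c * f x) = c * m f"
    and "f \<in> bounded_borel \<Longrightarrow> (\<And>x. 0 \<le> f x) \<Longrightarrow> 0 \<le> m f"
    and "m (\<lambda>x. 1) = 1"
proof -
  have *: "m \<in> F" if "closed F" "\<And>\<nu>. \<nu> \<in> Prob \<Longrightarrow> tau_embedding \<nu> \<in> F" for F
    using closure_minimal[of "tau_embedding ` B" F] that assms by blast
  have c: "continuous_on UNIV (\<lambda>m :: ('a \<Rightarrow> real) \<Rightarrow> real. m f)" for f by simp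
  show "m (\<lambda>x. f x + g x) = m f + m g" if "f \<in> bounded_borel" "g \<in> bounded_borel"
  proof -
    have "m \<in> {m. m (\<lambda>x. f x + g x) = m f + m g}"
      using that by (intro * closed_Collect_eq continuous_on_add c)
        (simp add: tau_embedding_def bounded_borel_add bounded_borel_integrable)
    then show ?thesis by simp
  qed
  show "m (\<lambda>x. c * f x) = c * m f" if "f \<in> bounded_borel"
  proof -
    have "m \<in> {m. m (\<lambda>x. c * f x) = c * m f}"
      using that by (intro * closed_Collect_eq continuous_on_mult continuous_on_const c)
        (simp add: tau_embedding_def bounded_borel_scale)
    then show ?thesis by simp
  qed
  show "0 \<le> m f" if "f \<in> bounded_borel" "\<And>x. 0 \<le> f x"
  proof -
    have "m \<in> {m. 0 \<le> m f}"
      using that by (intro * closed_Collect_le continuous_on_const c) (simp add: tau_embedding_def)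
    then show ?thesis by simp
  qed
  have "tau_embedding \<nu> (\<lambda>x. 1) = 1" if "\<nu> \<in> Prob" for \<nu> :: "'a measure"
    using prob_space.prob_space[OF ProbD(1)[OF that]] by (simp add: tau_embedding_def)
  then have "m \<in> {m. m (\<lambda>x. 1) = 1}"
    by (intro * closed_Collect_eq continuous_on_const c) simp
  then show "m (\<lambda>x. 1) = 1" by simp
qed

text \<open>Applying the bound to \<open>t * G n\<close> gives \<open>m (G n) \<le> (log_mgf \<mu> (t * G n) + a) / t\<close>. For fixed
  \<open>t\<close> the first summand vanishes as \<open>n\<close> grows, by dominated convergence, and the second is small
  if \<open>t\<close> is large. In this way the variational form of an entropy bound excludes limits that are
  only finitely additive.\<close>

lemma log_mgf_bound_imp_continuous:
  fixes m :: "('a::topological_space \<Rightarrow> real) \<Rightarrow> real"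
  assumes \<mu>: "\<mu> \<in> Prob"
    and scale: "\<And>c f. f \<in> bounded_borel \<Longrightarrow> m (\<lambda>x. c * f x) = c * m f"
    and pos: "\<And>f. f \<in> bounded_borel \<Longrightarrow> (\<And>x. 0 \<le> f x) \<Longrightarrow> 0 \<le> m f"
    and le: "\<And>f. f \<in> bounded_borel \<Longrightarrow> m f \<le> log_mgf \<mu> f + a"
    and G: "\<And>n. G n \<in> bounded_borel" "\<And>n x. 0 \<le> G n x" "\<And>x. decseq (\<lambda>n. G n x)"
      "\<And>x. (\<lambda>n. G n x) \<longlonglongrightarrow> 0"
  shows "(\<lambda>n. m (G n)) \<longlonglongrightarrow> 0"
proof -
  interpret prob_space \<mu> by (rule ProbD[OF \<mu>])
  note [measurable_cong] = ProbD(2)[OF \<mu>]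
  note [measurable] = bounded_borelD(1)[OF G(1)]
  have lim: "(\<lambda>n. log_mgf \<mu> (\<lambda>x. t * G n x)) \<longlonglongrightarrow> 0" if "0 < t" for t
  proof -
    have "(\<lambda>n. \<integral>x. exp (t * G n x) \<partial>\<mu>) \<longlonglongrightarrow> (\<integral>x. exp (t * 0) \<partial>\<mu>)"
    proof (rule integral_dominated_convergence[where w = "\<lambda>x. exp (t * G 0 x)"])
      show "integrable \<mu> (\<lambda>x. exp (t * G 0 x))"
        by (intro bounded_borel_integrable[OF \<mu>] bounded_borel_exp bounded_borel_scale G)
      show "AE x in \<mu>. (\<lambda>n. exp (t * G n x)) \<longlonglongrightarrow> exp (t * 0)"
        by (intro AE_I2 tendsto_intros G)
      show "AE x in \<mu>. norm (exp (t * G n x)) \<le> exp (t * G 0 x)" for n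
        using that decseqD[OF G(3), of 0 n] by auto
    qed auto
    then have "(\<lambda>n. ln (\<integral>x. exp (t * G n x) \<partial>\<mu>)) \<longlonglongrightarrow> ln 1"
      by (intro tendsto_ln) (auto simp: prob_space)
    then show ?thesis by (simp add: log_mgf_def)
  qed
  show ?thesis
  proof (rule LIMSEQ_I)
    fix e :: real assume e: "0 < e"
    \<comment> \<open>With this choice \<open>t * e = \<bar>a\<bar> + 1\<close>, which exceeds \<open>log_mgf \<mu> (t * G n) + a\<close> as soon as the
      logarithmic term is below \<open>1\<close>.\<close>
    define t where "t = (\<bar>a\<bar> + 1) / e"
    have t: "0 < t" using e by (simp add: t_def)
    from LIMSEQ_D[OF lim[OF t], of 1] obtain k
      where k: "\<And>n. k \<le> n \<Longrightarrow> \<bar>log_mgf \<mu> (\<lambda>x. t * G n x)\<bar> < 1" by auto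
    have "norm (m (G n) - 0) < e" if "k \<le> n" for n
    proof -
      have "t * m (G n) \<le> log_mgf \<mu> (\<lambda>x. t * G n x) + a"
        using le[OF bounded_borel_scale[OF G(1)], of t n] scale[OF G(1), of t n] by simp
      also have "\<dots> < t * e" using k[OF that] e by (simp add: t_def)
      finally show ?thesis using t pos[OF G(1) G(2), of n] by simp
    qed
    then show "\<exists>no. \<forall>n\<ge>no. norm (m (G n) - 0) < e" by blast
  qed
qed

text \<open>The closure of the embedded set \<open>B\<close> is compact. If the open half-spaces did not cover it, some
  point of it would satisfy all the inequalities of the variational bound. Such a point is a
  probability measure by the two preceding facts and Daniell's theorem, it lies in the
  \<open>\<tau>\<close>-closure of \<open>B\<close>, and its entropy is at most \<open>a\<close>. Hence finitely many half-spaces suffice.\<close>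

lemma finite_half_space_cover:
  fixes B :: "'a::topological_space measure set"
  assumes \<mu>: "\<mu> \<in> Prob" and B: "B \<subseteq> Prob"
    and a: "\<And>\<nu>. \<nu> \<in> tau_topology closure_of B \<Longrightarrow> ereal a < relative_entropy \<nu> \<mu>"
  obtains G where "finite G" "G \<subseteq> bounded_borel"
    "\<And>\<nu>. \<nu> \<in> B \<Longrightarrow> \<exists>g\<in>G. log_mgf \<mu> g + a < (\<integral>x. g x \<partial>\<nu>)"
proof -
  let ?K = "closure (tau_embedding ` B)"
  define b where "b f = (if f \<in> bounded_borel then SOME b. \<forall>x. \<bar>f x\<bar> \<le> b else 0)" for f :: "'a \<Rightarrow> real"
  have b: "\<bar>f x\<bar> \<le> b f" if "f \<in> bounded_borel" for f x
    using someI_ex[of "\<lambda>b. \<forall>x. \<bar>f x\<bar> \<le> b"] bounded_borelD(2)[OF that] that by (auto simp: b_def)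
  have "\<bar>tau_embedding \<nu> f\<bar> \<le> b f" if "\<nu> \<in> B" for \<nu> f
  proof (cases "f \<in> bounded_borel")
    case True
    interpret prob_space \<nu> using that B ProbD(1) by blast
    have "\<bar>\<integral>x. f x \<partial>\<nu>\<bar> \<le> (\<integral>x. \<bar>f x\<bar> \<partial>\<nu>)" by (rule integral_abs_bound)
    also have "\<dots> \<le> b f"
      using True b that B by (intro integral_le_const integrable_abs) (auto intro!: bounded_borel_integrable)
    finally show ?thesis using True by (simp add: tau_embedding_def)
  qed (simp add: tau_embedding_def b_def)
  then have sub: "tau_embedding ` B \<subseteq> {m. \<forall>f. \<bar>m f\<bar> \<le> b f}" by auto
  have "closed {m :: ('a \<Rightarrow> real) \<Rightarrow> real. \<forall>f. \<bar>m f\<bar> \<le> b f}"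
    by (intro closed_Collect_all closed_Collect_le continuous_on_const continuous_on_rabs) simp
  then have "?K \<subseteq> {m. \<forall>f. \<bar>m f\<bar> \<le> b f}" using sub by (rule closure_minimal[rotated])
  then have "compact ?K"
    using compact_Int_closed[OF compact_pointwise_bounded[of b] closed_closure[of "tau_embedding ` B"]]
    by (simp add: inf.absorb2)
  have cover: "?K \<subseteq> (\<Union>g\<in>bounded_borel. {m. log_mgf \<mu> g + a < m g})"
  proof (rule ccontr)
    assume "\<not> ?thesis"
    then obtain m where m: "m \<in> ?K" and "m \<notin> (\<Union>g\<in>bounded_borel. {m. log_mgf \<mu> g + a < m g})"
      by (meson subsetI)
    then have le: "m g \<le> log_mgf \<mu> g + a" if "g \<in> bounded_borel" for g
      using that by (metis (mono_tags, lifting) UN_I mem_Collect_eq not_le)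
    note lin = closure_tau_embedding_linear[OF B m]
    have "\<exists>\<nu>\<in>Prob. \<forall>f\<in>bounded_borel. (\<integral>x. f x \<partial>\<nu>) = m f"
    proof (rule daniell_representation[of m])
      show "(\<lambda>n. m (F n)) \<longlonglongrightarrow> 0"
        if "\<And>n. F n \<in> bounded_borel" "\<And>n x. 0 \<le> F n x" "\<And>x. decseq (\<lambda>n. F n x)"
          "\<And>x. (\<lambda>n. F n x) \<longlonglongrightarrow> 0" for F
        by (rule log_mgf_bound_imp_continuous[OF \<mu> lin(2,3) le that])
      show "m (\<lambda>x. f x + g x) = m f + m g" if "f \<in> bounded_borel" "g \<in> bounded_borel" for f g
        using that by (rule lin(1))
      show "m (\<lambda>x. c * f x) = c * m f" if "f \<in> bounded_borel" for c f using that by (rule lin(2))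
      show "0 \<le> m f" if "f \<in> bounded_borel" "\<And>x. 0 \<le> f x" for f using that by (rule lin(3))
      show "m (\<lambda>x. 1) = 1" by (rule lin(4))
    qed (rule bexI, rule ballI)
    then obtain \<nu> where \<nu>: "\<nu> \<in> Prob" "\<And>f. f \<in> bounded_borel \<Longrightarrow> (\<integral>x. f x \<partial>\<nu>) = m f"
      by (elim bexE) (simp add: Ball_def)
    \<comment> \<open>The coordinates outside the bounded Borel functions vanish on the whole closure.\<close>
    have "m f = 0" if "f \<notin> bounded_borel" for f
    proof -
      have "closed {m :: ('a \<Rightarrow> real) \<Rightarrow> real. m f = 0}"
        by (intro closed_Collect_eq continuous_on_const) simp
      moreover have "tau_embedding ` B \<subseteq> {m. m f = 0}" using that by (auto simp: tau_embedding_def)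
      ultimately have "?K \<subseteq> {m. m f = 0}" by (rule closure_minimal[rotated])
      from subsetD[OF this m] show ?thesis by simp
    qed
    then have "tau_embedding \<nu> f = m f" for f using \<nu>(2)[of f] by (simp add: tau_embedding_def)
    then have "tau_embedding \<nu> = m" by (rule ext)
    then have "\<nu> \<in> tau_topology closure_of B"
      using closure_tau_embedding_imp_tau_closure[OF \<nu>(1) _ B] m by simp
    moreover have "relative_entropy \<nu> \<mu> \<le> ereal a"
      using \<nu> le by (intro relative_entropy_le_of_variational_bound[OF \<mu>]) auto
    ultimately show False using a[of \<nu>] by simp
  qed
  have open_half: "open {m :: ('a \<Rightarrow> real) \<Rightarrow> real. log_mgf \<mu> g + a < m g}" for g
    by (intro open_Collect_less continuous_on_const) simp
  obtain G where G: "G \<subseteq> bounded_borel" "finite G" "?K \<subseteq> (\<Union>g\<in>G. {m. log_mgf \<mu> g + a < m g})"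
    by (rule compactE_image[OF \<open>compact ?K\<close> _ cover]) (rule open_half)
  show ?thesis
  proof (rule that[OF G(2,1)])
    fix \<nu> assume "\<nu> \<in> B"
    then have "tau_embedding \<nu> \<in> ?K" by (intro subsetD[OF closure_subset] imageI)
    then have "tau_embedding \<nu> \<in> (\<Union>g\<in>G. {m. log_mgf \<mu> g + a < m g})" by (rule subsetD[OF G(3)])
    then obtain g where "g \<in> G" "log_mgf \<mu> g + a < tau_embedding \<nu> g" by auto
    then show "\<exists>g\<in>G. log_mgf \<mu> g + a < (\<integral>x. g x \<partial>\<nu>)"
      using G(1) by (auto simp: tau_embedding_def subset_iff)
  qed
qed

section \<open>Empirical measures\<close>

lemma empirical_measure_eq_distr:
  fixes x :: "nat \<Rightarrow> 'a::topological_space"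
  assumes n: "1 \<le> n"
  shows "empirical_measure n x = distr (measure_pmf (pmf_of_set {1..n})) borel x"
proof (rule measure_eqI)
  show "sets (empirical_measure n x) = sets (distr (measure_pmf (pmf_of_set {1..n})) borel x)"
    by (simp add: sets_empirical_measure)
  fix A assume "A \<in> sets (empirical_measure n x)"
  then have A: "A \<in> sets borel" by (simp add: sets_empirical_measure)
  have "emeasure (distr (measure_pmf (pmf_of_set {1..n})) borel x) A
      = (\<integral>\<^sup>+i. indicator (x -` A) i \<partial>measure_pmf (pmf_of_set {1..n}))"
    using A by (simp add: emeasure_distr)
  also have "\<dots> = (\<Sum>i=1..n. indicator A (x i)) / of_nat n"
    using n by (subst nn_integral_pmf_of_set) (auto simp: indicator_def vimage_def ennreal_of_nat_eq_real_of_nat)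
  finally show "emeasure (empirical_measure n x) A
      = emeasure (distr (measure_pmf (pmf_of_set {1..n})) borel x) A"
    using A by (simp add: emeasure_empirical_measure)
qed

lemma empirical_measure_Prob:
  assumes "1 \<le> n" shows "empirical_measure n x \<in> Prob"
  by (simp add: empirical_measure_eq_distr[OF assms] Prob_def measure_pmf.prob_space_distr)

lemma integral_empirical_measure:
  fixes g :: "'a::topological_space \<Rightarrow> real"
  assumes "1 \<le> n" and "g \<in> borel_measurable borel"
  shows "(\<integral>y. g y \<partial>empirical_measure n x) = (\<Sum>i=1..n. g (x i)) / real n"
  using assms by (simp add: empirical_measure_eq_distr integral_distr integral_pmf_of_set)

section \<open>Exponential moments of the number of occurrences\<close>

text \<open>If infinitely many of the events occur, every one of them adds at least \<open>1\<close> to the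
  right-hand side. Otherwise their number is at most the index (counted from \<open>1\<close>) of the last one,
  whose term alone dominates the left-hand side.\<close>

lemma exp_num_le_suminf:
  fixes A :: "nat \<Rightarrow> 'w set"
  assumes "0 \<le> p"
  shows "eexp (ereal p * (\<Sum>n. indicator (A n) \<omega>))
      \<le> 1 + (\<Sum>n. ennreal (exp (p * real (Suc n))) * indicator (A n) \<omega>)" (is "?L \<le> 1 + ?R")
proof -
  define S where "S = {n. \<omega> \<in> A n}"
  show ?thesis
  proof (cases "finite S")
    case True
    have "(\<Sum>n. indicator (A n) \<omega> :: ereal) = (\<Sum>n\<in>S. indicator (A n) \<omega>)"
      using True by (intro suminf_finite) (auto simp: S_def)
    also have "\<dots> = (\<Sum>n\<in>S. ereal 1)" by (intro sum.cong) (auto simp: S_def)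
    also have "\<dots> = ereal (real (card S))" by simp
    finally have L: "?L = ennreal (exp (p * real (card S)))" by (simp add: eexp_def)
    show ?thesis
    proof (cases "S = {}")
      case True then show ?thesis by (simp add: L)
    next
      case False
      define N where "N = Max S"
      have "S \<subseteq> {..N}" "N \<in> S" using True False by (auto simp: N_def)
      then have "card S \<le> Suc N" using card_mono[of "{..N}" S] by simp
      then have "?L \<le> ennreal (exp (p * real (Suc N))) * indicator (A N) \<omega>"
        using \<open>N \<in> S\<close> assms by (auto simp: L S_def intro!: ennreal_leI mult_left_mono)
      also have "\<dots> \<le> ?R"
      proof -
        define h where "h n = ennreal (exp (p * real (Suc n))) * indicator (A n) \<omega>" for n
        have "sum h {N} \<le> suminf h" by (intro sum_le_suminf) auto
        then have "h N \<le> suminf h" by simp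
        then show ?thesis unfolding h_def .
      qed
      finally show ?thesis by (simp add: add_increasing)
    qed
  next
    case False
    have "of_nat k \<le> ?R" for k
    proof -
      obtain F where F: "F \<subseteq> S" "finite F" "card F = k"
        using infinite_arbitrarily_large[OF False] by blast
      have "of_nat k = (\<Sum>n\<in>F. 1 :: ennreal)" using F by simp
      also have "\<dots> \<le> (\<Sum>n\<in>F. ennreal (exp (p * real (Suc n))) * indicator (A n) \<omega>)"
        using F assms by (intro sum_mono) (auto simp: S_def subset_iff)
      also have "\<dots> \<le> ?R" using F by (intro sum_le_suminf) auto
      finally show ?thesis .
    qed
    then have "?R = top"
      using ennreal_Ex_less_of_nat[of ?R] by (meson leD top.not_eq_extremum)
    then show ?thesis by simp
  qed
qed

section \<open>Large deviations of the empirical measures of an i.i.d. sequence\<close>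

locale iid_sequence = prob_space M for M :: "'w measure" +
  fixes X :: "nat \<Rightarrow> 'w \<Rightarrow> 'a::topological_space" and \<mu> :: "'a measure"
  assumes indep: "indep_vars (\<lambda>_. borel) X {1..}"
    and distributed_\<mu>: "1 \<le> i \<Longrightarrow> distr M borel (X i) = \<mu>"
begin

lemma X_measurable: "1 \<le> i \<Longrightarrow> X i \<in> borel_measurable M"
  using indep by (auto simp: indep_vars_def)

lemma \<mu>_Prob: "\<mu> \<in> Prob"
  using distributed_\<mu>[of 1] prob_space_distr[OF X_measurable[of 1]] by (auto simp: Prob_def)

lemma measurable_integral_empirical:
  fixes g :: "'a \<Rightarrow> real"
  assumes "1 \<le> n" "g \<in> borel_measurable borel"
  shows "(\<lambda>\<omega>. \<integral>y. g y \<partial>empirical_measure n (\<lambda>i. X i \<omega>)) \<in> borel_measurable M"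
proof -
  have "(\<lambda>\<omega>. g (X i \<omega>)) \<in> borel_measurable M" if "1 \<le> i" for i
    using measurable_compose[OF X_measurable[OF that] assms(2)] .
  then show ?thesis
    unfolding integral_empirical_measure[OF assms] by (intro borel_measurable_divide borel_measurable_sum) auto
qed

lemma empirical_event_measurable:
  assumes "1 \<le> n" "B \<in> sets tau_algebra"
  shows "empirical_event M X B n \<in> sets M"
proof -
  have "(\<lambda>\<omega>. empirical_measure n (\<lambda>i. X i \<omega>)) \<in> measurable M tau_algebra"
    unfolding tau_algebra_def
  proof (rule measurable_measure_of)
    fix Y :: "'a measure set"
    assume "Y \<in> {{\<nu> \<in> Prob. (\<integral>x. f x \<partial>\<nu>) \<in> A} | f A. f \<in> bounded_borel \<and> A \<in> sets (borel :: real measure)}"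
    then obtain f A where f: "f \<in> bounded_borel" and A: "A \<in> sets borel"
      and Y: "Y = {\<nu> \<in> Prob. (\<integral>x. f x \<partial>\<nu>) \<in> A}" by blast
    have "(\<lambda>\<omega>. empirical_measure n (\<lambda>i. X i \<omega>)) -` Y \<inter> space M
        = (\<lambda>\<omega>. \<integral>y. f y \<partial>empirical_measure n (\<lambda>i. X i \<omega>)) -` A \<inter> space M"
      using empirical_measure_Prob[OF assms(1)] by (auto simp: Y)
    then show "(\<lambda>\<omega>. empirical_measure n (\<lambda>i. X i \<omega>)) -` Y \<inter> space M \<in> sets M"
      using measurable_sets[OF measurable_integral_empirical[OF assms(1) bounded_borelD(1)[OF f]] A] by simp
  qed (auto simp: empirical_measure_Prob[OF assms(1)])
  from measurable_sets[OF this assms(2)] show ?thesis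
    by (simp add: empirical_event_def vimage_def Int_def conj_commute)
qed

text \<open>Markov's inequality for the product of the independent variables \<open>exp (g (X i))\<close>.\<close>

lemma chernoff_half_space:
  assumes n: "1 \<le> n" and g: "g \<in> bounded_borel"
  shows "prob {\<omega> \<in> space M. log_mgf \<mu> g + a < (\<integral>y. g y \<partial>empirical_measure n (\<lambda>i. X i \<omega>))}
    \<le> exp (- a * real n)" (is "prob ?H \<le> _")
proof -
  let ?Y = "\<lambda>i \<omega>. exp (g (X i \<omega>))"
  have exp_meas: "(\<lambda>x. exp (g x)) \<in> borel_measurable borel" using bounded_borelD(1)[OF g] by simp
  have ind: "indep_vars (\<lambda>_. borel) ?Y {1..n}"
    using indep_vars_subset[OF indep, of "{1..n}"] by (rule indep_vars_compose2) (use exp_meas in auto)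
  have int_i: "integrable M (?Y i)" if "1 \<le> i" for i
    using bounded_borel_integrable[OF \<mu>_Prob bounded_borel_exp[OF g]] that
    unfolding distributed_\<mu>[OF that, symmetric] by (subst (asm) integrable_distr_eq) (use X_measurable exp_meas in auto)
  have mgf_i: "expectation (?Y i) = exp (log_mgf \<mu> g)" if "1 \<le> i" for i
  proof -
    have "expectation (?Y i) = (\<integral>x. exp (g x) \<partial>\<mu>)"
      unfolding distributed_\<mu>[OF that, symmetric] using that X_measurable exp_meas
      by (subst integral_distr) auto
    then show ?thesis using integral_exp_pos[OF \<mu>_Prob g] by (simp add: log_mgf_def)
  qed
  have int: "integrable M (\<lambda>\<omega>. \<Prod>i\<in>{1..n}. ?Y i \<omega>)"
    using ind int_i by (intro indep_vars_integrable) auto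
  have "expectation (\<lambda>\<omega>. \<Prod>i\<in>{1..n}. ?Y i \<omega>) = (\<Prod>i\<in>{1..n}. expectation (?Y i))"
    using ind int_i by (intro indep_vars_lebesgue_integral) auto
  also have "\<dots> = exp (real n * log_mgf \<mu> g)" by (simp add: mgf_i exp_of_nat_mult)
  finally have mgf: "expectation (\<lambda>\<omega>. \<Prod>i\<in>{1..n}. ?Y i \<omega>) = exp (real n * log_mgf \<mu> g)" .
  let ?c = "exp (real n * (log_mgf \<mu> g + a))"
  have "?H \<subseteq> {\<omega> \<in> space M. ?c \<le> (\<Prod>i\<in>{1..n}. ?Y i \<omega>)}"
  proof (intro subsetI CollectI conjI)
    fix \<omega> assume \<omega>: "\<omega> \<in> ?H"
    then show "\<omega> \<in> space M" by simp
    from \<omega> have "log_mgf \<mu> g + a < (\<Sum>i=1..n. g (X i \<omega>)) / real n"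
      by (simp add: integral_empirical_measure[OF n bounded_borelD(1)[OF g]])
    then have "real n * (log_mgf \<mu> g + a) \<le> (\<Sum>i=1..n. g (X i \<omega>))"
      using n by (simp add: pos_less_divide_eq mult.commute)
    then show "?c \<le> (\<Prod>i\<in>{1..n}. ?Y i \<omega>)" by (subst exp_sum[symmetric]) auto
  qed
  then have "prob ?H \<le> prob {\<omega> \<in> space M. ?c \<le> (\<Prod>i\<in>{1..n}. ?Y i \<omega>)}"
    using int by (intro finite_measure_mono) auto
  also have "\<dots> \<le> expectation (\<lambda>\<omega>. \<Prod>i\<in>{1..n}. ?Y i \<omega>) / ?c"
    using int by (intro integral_Markov_inequality_measure[where A = "space M"]) (auto intro!: prod_nonneg)
  also have "\<dots> = exp (- a * real n)"
    unfolding mgf by (subst exp_diff[symmetric]) (simp add: algebra_simps)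
  finally show ?thesis .
qed

text \<open>A union bound over the finitely many half-spaces that cover \<open>B\<close>. The constant is their number,
  enlarged by one to be positive.\<close>

lemma empirical_event_exponential_bound:
  assumes B: "B \<in> sets tau_algebra"
    and a: "ereal a < (INF \<nu> \<in> tau_topology closure_of B. relative_entropy \<nu> \<mu>)"
  shows "\<exists>C>0. \<forall>n\<ge>1. prob (empirical_event M X B n) \<le> C * exp (- a * real n)"
proof -
  have BP: "B \<subseteq> Prob"
    using sets.sets_into_space[OF B] by (auto simp: tau_algebra_def space_measure_of_conv)
  have "ereal a < relative_entropy \<nu> \<mu>" if "\<nu> \<in> tau_topology closure_of B" for \<nu>
    using a that by (meson INF_lower less_le_trans)
  from finite_half_space_cover[OF \<mu>_Prob BP this] obtain G where
    G: "finite G" "G \<subseteq> bounded_borel" "\<And>\<nu>. \<nu> \<in> B \<Longrightarrow> \<exists>g\<in>G. log_mgf \<mu> g + a < (\<integral>x. g x \<partial>\<nu>)" by blast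
  show ?thesis
  proof (intro exI[of _ "real (card G) + 1"] conjI allI impI)
    fix n :: nat assume n: "1 \<le> n"
    define H where "H g = {\<omega> \<in> space M. log_mgf \<mu> g + a < (\<integral>y. g y \<partial>empirical_measure n (\<lambda>i. X i \<omega>))}" for g
    have H: "H g \<in> sets M" if "g \<in> G" for g
    proof -
      have [measurable]: "(\<lambda>\<omega>. \<integral>y. g y \<partial>empirical_measure n (\<lambda>i. X i \<omega>)) \<in> borel_measurable M"
        using that G(2) by (intro measurable_integral_empirical[OF n] bounded_borelD(1)) auto
      show ?thesis unfolding H_def by measurable
    qed
    have "prob (empirical_event M X B n) \<le> prob (\<Union>g\<in>G. H g)"
      using H G(1,3) by (intro finite_measure_mono) (auto simp: empirical_event_def H_def)
    also have "\<dots> \<le> (\<Sum>g\<in>G. prob (H g))"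
      using G(1) H by (intro finite_measure_subadditive_finite) auto
    also have "\<dots> \<le> (\<Sum>g\<in>G. exp (- a * real n))"
      using G(2) chernoff_half_space[OF n] by (intro sum_mono) (auto simp: H_def)
    also have "\<dots> \<le> (real (card G) + 1) * exp (- a * real n)" by (simp add: algebra_simps)
    finally show "prob (empirical_event M X B n) \<le> (real (card G) + 1) * exp (- a * real n)" .
  qed simp
qed

lemma limsup_empirical_event:
  assumes B: "B \<in> sets tau_algebra"
    and a: "ereal a < (INF \<nu> \<in> tau_topology closure_of B. relative_entropy \<nu> \<mu>)"
  shows "limsup (\<lambda>n. ereal (1 / real n) * eln (prob (empirical_event M X B n))) \<le> ereal (- a)"
proof -
  obtain C where C: "0 < C" "\<forall>n\<ge>1. prob (empirical_event M X B n) \<le> C * exp (- a * real n)"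
    using empirical_event_exponential_bound[OF B a] by blast
  have "ereal (1 / real n) * eln (prob (empirical_event M X B n)) \<le> ereal (ln C / real n - a)" if n: "1 \<le> n" for n
  proof (cases "prob (empirical_event M X B n) = 0")
    case False
    then have "0 < prob (empirical_event M X B n)" by (simp add: zero_less_measure_iff)
    with C(2)[rule_format, OF n] have "ln (prob (empirical_event M X B n)) \<le> ln (C * exp (- a * real n))"
      by (intro ln_mono)
    also have "\<dots> = ln C - a * real n" using C(1) by (simp add: ln_mult)
    finally have "1 / real n * ln (prob (empirical_event M X B n)) \<le> 1 / real n * (ln C - a * real n)"
      by (intro mult_left_mono) auto
    also have "\<dots> = ln C / real n - a" using n by (simp add: field_simps)
    finally show ?thesis using False by (simp add: eln_def)
  qed (use n in \<open>simp add: eln_def\<close>)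
  then have "limsup (\<lambda>n. ereal (1 / real n) * eln (prob (empirical_event M X B n)))
      \<le> limsup (\<lambda>n. ereal (ln C / real n - a))"
    by (intro Limsup_mono eventually_sequentiallyI[of 1]) auto
  also have "\<dots> = ereal (- a)"
  proof (rule lim_imp_Limsup)
    have "(\<lambda>n. ln C * (1 / real n) - a) \<longlonglongrightarrow> ln C * 0 - a"
      by (intro tendsto_intros lim_1_over_n)
    then show "(\<lambda>n. ereal (ln C / real n - a)) \<longlonglongrightarrow> ereal (- a)" by simp
  qed simp
  finally show ?thesis .
qed

lemma exp_moment_num_occurrences_finite:
  assumes B: "B \<in> sets tau_algebra"
    and p: "0 < p" "ereal p < (INF \<nu> \<in> tau_topology closure_of B. relative_entropy \<nu> \<mu>)"
  shows "(\<integral>\<^sup>+\<omega>. eexp (ereal p * num_occurrences M X B \<omega>) \<partial>M) < top"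
proof -
  let ?E = "\<lambda>n. empirical_event M X B (Suc n)"
  have E[measurable]: "?E n \<in> sets M" for n by (rule empirical_event_measurable[OF _ B]) simp
  \<comment> \<open>A rate strictly above \<open>p\<close> makes the series in the bound below geometric.\<close>
  obtain a where a: "p < a" "ereal a < (INF \<nu> \<in> tau_topology closure_of B. relative_entropy \<nu> \<mu>)"
    using ereal_dense2[OF p(2)] by auto
  obtain C where C: "0 < C" "\<forall>n\<ge>1. prob (empirical_event M X B n) \<le> C * exp (- a * real n)"
    using empirical_event_exponential_bound[OF B a(2)] by blast
  have "(\<integral>\<^sup>+\<omega>. eexp (ereal p * num_occurrences M X B \<omega>) \<partial>M)
      \<le> (\<integral>\<^sup>+\<omega>. 1 + (\<Sum>n. ennreal (exp (p * real (Suc n))) * indicator (?E n) \<omega>) \<partial>M)"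
    unfolding num_occurrences_def using p(1) by (intro nn_integral_mono exp_num_le_suminf) simp
  also have "\<dots> = 1 + (\<Sum>n. ennreal (exp (p * real (Suc n))) * emeasure M (?E n))"
    by (subst nn_integral_add) (auto simp: nn_integral_suminf nn_integral_cmult_indicator emeasure_space_1 simp del: of_nat_Suc)
  also have "\<dots> \<le> 1 + (\<Sum>n. ennreal (C * exp (- (a - p)) ^ Suc n))"
  proof (intro add_left_mono suminf_le)
    fix n
    have "ennreal (exp (p * real (Suc n))) * emeasure M (?E n) = ennreal (exp (p * real (Suc n)) * prob (?E n))"
      by (simp add: emeasure_eq_measure ennreal_mult)
    also have "exp (p * real (Suc n)) * prob (?E n) \<le> exp (p * real (Suc n)) * (C * exp (- a * real (Suc n)))"
      by (intro mult_left_mono C(2)[rule_format]) auto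
    also have "\<dots> = C * exp (- (a - p)) ^ Suc n"
    proof -
      have "exp (p * real (Suc n)) * (C * exp (- a * real (Suc n))) = C * exp (p * real (Suc n) + - a * real (Suc n))"
        by (simp only: exp_add mult.left_commute)
      also have "p * real (Suc n) + - a * real (Suc n) = real (Suc n) * - (a - p)"
        by (simp add: algebra_simps)
      finally show ?thesis by (simp only: exp_of_nat_mult)
    qed
    finally show "ennreal (exp (p * real (Suc n))) * emeasure M (?E n) \<le> ennreal (C * exp (- (a - p)) ^ Suc n)"
      by (simp add: ennreal_leI)
  qed auto
  also have "\<dots> < top"
  proof -
    have "summable (\<lambda>n. C * exp (- (a - p)) ^ Suc n)"
      using a(1) by (intro summable_mult) (simp add: summable_mult summable_geometric)
    then have "(\<Sum>n. ennreal (C * exp (- (a - p)) ^ Suc n)) \<noteq> top"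
      by (rule ennreal_suminf_neq_top) (use C(1) in simp)
    then have "(\<Sum>n. ennreal (C * exp (- (a - p)) ^ Suc n)) < top"
      by (rule top.not_eq_extremum[THEN iffD1])
    then show ?thesis by (simp only: ennreal_add_less_top ennreal_one_less_top simp_thms)
  qed
  finally show ?thesis .
qed

text \<open>Markov's inequality.\<close>

lemma num_occurrences_tail:
  assumes p: "0 < p"
  shows "emeasure M {\<omega> \<in> space M. num_occurrences M X B \<omega> \<ge> ereal (real k)}
    \<le> (\<integral>\<^sup>+\<omega>. eexp (ereal p * num_occurrences M X B \<omega>) \<partial>M) * ennreal (exp (- p * real k))"
    (is "emeasure M ?A \<le> ?J * _")
proof (cases "?A \<in> sets M")
  case True
  have "ennreal (exp (p * real k)) * indicator ?A \<omega> \<le> eexp (ereal p * num_occurrences M X B \<omega>)" for \<omega>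
  proof (cases "\<omega> \<in> ?A")
    case True
    then show ?thesis using p
      by (cases "num_occurrences M X B \<omega>") (auto simp: eexp_def ennreal_leI)
  qed auto
  then have "(\<integral>\<^sup>+\<omega>. ennreal (exp (p * real k)) * indicator ?A \<omega> \<partial>M) \<le> ?J" by (intro nn_integral_mono) auto
  then have "ennreal (exp (p * real k)) * emeasure M ?A \<le> ?J"
    using True by (simp add: nn_integral_cmult_indicator)
  then have "ennreal (exp (- p * real k)) * (ennreal (exp (p * real k)) * emeasure M ?A) \<le> ennreal (exp (- p * real k)) * ?J"
    by (rule mult_left_mono) simp
  moreover have "ennreal (exp (- p * real k)) * (ennreal (exp (p * real k)) * emeasure M ?A) = emeasure M ?A"
    by (simp add: mult.assoc[symmetric] ennreal_mult[symmetric] exp_add[symmetric])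
  ultimately show ?thesis by (simp add: mult.commute)
next
  case False
  \<comment> \<open>A set that is not measurable has measure \<open>0\<close>.\<close>
  then show ?thesis by (simp add: emeasure_notin_sets)
qed

end

lemma inverse_one_minus_ge_1: "1 \<le> inverse (1 - x)" for x :: ennreal
proof -
  have "1 - x \<le> 1" by (rule diff_le_self_ennreal)
  then obtain r where r: "1 - x = ennreal r" "0 \<le> r" "r \<le> 1"
    by (cases "1 - x" rule: ennreal_cases) (auto simp: top_unique)
  show ?thesis
  proof (cases "r = 0")
    case False
    then have "1 \<le> inverse r" using r by (simp add: one_le_inverse_iff)
    then show ?thesis using False r by (simp add: inverse_ennreal)
  qed (simp add: r)
qed

theorem theorem10:
  fixes M :: "'w measure"
    and X :: "nat \<Rightarrow> 'w \<Rightarrow> 'a::polish_space"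
    and \<mu> :: "'a measure"
    and B :: "'a measure set"
    and I :: ereal
  assumes "prob_space M"
    and "prob_space.indep_vars M (\<lambda>_. borel) X {1..}"
    and "\<And>i. i \<ge> 1 \<Longrightarrow> distr M borel (X i) = \<mu>"
    and "B \<in> sets tau_algebra"
  defines "I \<equiv> (INF \<nu> \<in> tau_topology closure_of B. relative_entropy \<nu> \<mu>)"
  shows "limsup (\<lambda>n. ereal (1 / real n) * eln (measure M (empirical_event M X B n))) \<le> - I
    \<and> (\<forall>p::real. 0 < p \<and> ereal p < I \<longrightarrow>
        (\<exists>C::real. C > 0 \<and>
          (let K = ennreal C * inverse (1 - eexp (- I)) * inverse (1 - eexp (- (I - ereal p)))
           in (\<integral>\<^sup>+\<omega>. eexp (ereal p * num_occurrences M X B \<omega>) \<partial>M) \<le> K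
            \<and> (\<forall>k::nat. emeasure M {\<omega> \<in> space M. num_occurrences M X B \<omega> \<ge> ereal (real k)}
                  \<le> K * ennreal (exp (- p * real k))))))"
proof (intro conjI allI impI)
  interpret iid_sequence M X \<mu>
    using assms(1-3) by (simp add: iid_sequence_def iid_sequence_axioms_def)
  let ?l = "limsup (\<lambda>n. ereal (1 / real n) * eln (measure M (empirical_event M X B n)))"
  show "?l \<le> - I"
  proof (rule ccontr)
    assume "\<not> ?l \<le> - I"
    then have "- ?l < I" by (simp add: not_le ereal_uminus_less_reorder)
    then obtain a where a: "- ?l < ereal a" "ereal a < I" using ereal_dense2 by blast
    then have "?l \<le> ereal (- a)" using limsup_empirical_event[OF assms(4)] by (simp add: I_def)
    then show False using a(1) by (metis ereal_minus_le_minus uminus_ereal.simps(1) not_le ereal_uminus_uminus)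
  qed
  fix p :: real assume p: "0 < p \<and> ereal p < I"
  let ?J = "\<integral>\<^sup>+\<omega>. eexp (ereal p * num_occurrences M X B \<omega>) \<partial>M"
  have "?J < top" using exp_moment_num_occurrences_finite[OF assms(4)] p by (simp add: I_def)
  \<comment> \<open>Both further factors are at least \<open>1\<close>, so the exponential moment itself can serve as the
    constant; one is added to make it positive.\<close>
  define C where "C = enn2real ?J + 1"
  have "0 < C" by (simp add: C_def add_nonneg_pos)
  define K where "K = ennreal C * inverse (1 - eexp (- I)) * inverse (1 - eexp (- (I - ereal p)))"
  have "?J \<le> ennreal C" using \<open>?J < top\<close> by (cases ?J rule: ennreal_cases) (auto simp: C_def ennreal_leI simp del: ennreal_plus)
  also have "ennreal C * 1 * 1 \<le> K"
    unfolding K_def by (intro mult_mono inverse_one_minus_ge_1) auto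
  finally have JK: "?J \<le> K" by simp
  have tail: "emeasure M {\<omega> \<in> space M. num_occurrences M X B \<omega> \<ge> ereal (real k)} \<le> K * ennreal (exp (- p * real k))" for k
    using num_occurrences_tail[of p k B] p mult_right_mono[OF JK, of "ennreal (exp (- p * real k))"] by (auto intro: order_trans)
  show "\<exists>C>0. let K = ennreal C * inverse (1 - eexp (- I)) * inverse (1 - eexp (- (I - ereal p)))
      in ?J \<le> K \<and> (\<forall>k::nat. emeasure M {\<omega> \<in> space M. num_occurrences M X B \<omega> \<ge> ereal (real k)}
          \<le> K * ennreal (exp (- p * real k)))"
    unfolding Let_def using \<open>0 < C\<close> JK tail unfolding K_def by blast
qed

end
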